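(* Let $\Gamma$ be a finite directed graph and let $\mathcal{S}(\Gamma)$ be its graph inverse semigroup. Then there are three types of proper closed inverse subsemigroups of $\mathcal{S}(\Gamma)$; that is, every proper closed inverse subsemigroup $L$ of $\mathcal{S}(\Gamma)$ is of one of the following types. (a) Finite chain type: $L$ consists of a finite chain of idempotents. (b) Infinite chain type: $L$ consists of an infinite chain of idempotents. (c) Cycle type: $L$ has the form $$L = L_{p,d} = \{ (vp^{r}d,\,vp^{s}d) : r,s \geq 0,\ v \text{ a suffix of } p \} \cup \{(q,q) : q \text{ a suffix of } d \},$$ where $p$ is a directed circuit in $\Gamma$, $d$ is a directed path in $\Gamma$ starting at the initial point of $p$, and $p,d$ do not share a non-trivial prefix. In this case, $L$ is the smallest closed inverse subsemigroup of $\mathcal{S}(\Gamma)$ containing $(d,pd)$.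
   Context: Paths: a path in a directed graph $\Gamma$ is a directed path; a single vertex is allowed as an empty (length zero) path. $\mathbf{d}(v)$ and $\mathbf{r}(v)$ denote the initial and terminal vertices of a path $v$. Paths are composed left to right: $pv$ is $p$ followed by $v$, defined when $\mathbf{r}(p)=\mathbf{d}(v)$. A path $v$ is a suffix of $u$ if $u=pv$ for some (possibly empty) path $p$, and a prefix of $u$ if $u=vp$ for some (possibly empty) path $p$. A directed circuit is a path of positive length whose initial and terminal vertices coincide; $p^r$ denotes its $r$-fold power, and $p^0$ is the empty path at $\mathbf{d}(p)$. Two paths share a non-trivial prefix if there is a path of positive length that is a prefix of both. Graph inverse semigroup: $\mathcal{S}(\Gamma)$ has underlying set $\{(v,w): v,w \text{ paths in } \Gamma,\ \mathbf{d}(v)=\mathbf{d}(w)\}\cup\{0\}$, where $0$ is a zero element, with product $$(t,u)(v,w)=\begin{cases}(t,pw) & \text{if } u=pv \text{ for a path } p,\\ (pt,w) & \text{if } v=pu \text{ for a path } p,\\ 0 & \text{otherwise.}\end{cases}$$ It is an inverse semigroup with $(v,w)^{-1}=(w,v)$. Its idempotents are $0$ and the elements $(u,u)$. Order and closure: in an inverse semigroup $S$ the natural partial order is $s\leq t$ iff $s=et$ for some idempotent $e$. (In $\mathcal{S}(\Gamma)$, for nonzero elements, $(t,u)\leq (v,w)$ iff there is a path $p$ with $t=pv$ and $u=pw$.) A subset $A\subseteq S$ is closed if $a\in A$ and $a\leq s$ imply $s\in A$. An inverse subsemigroup is a non-empty subset closed under products and inverses; it is proper if it is not equal to $S$. A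 chain of idempotents is a set of idempotents totally ordered by the natural partial order. *)

theory Defs
  imports "Graph_Theory.Graph_Theory"
begin

section \<open>Closed inverse subsemigroups\<close>

text \<open>
  A semigroup is given by its carrier \<open>S\<close>, its product \<open>m\<close> and, for an inverse semigroup,
  its inversion map \<open>i\<close>.
\<close>

definition idempotents :: "'s set \<Rightarrow> ('s \<Rightarrow> 's \<Rightarrow> 's) \<Rightarrow> 's set" where
  "idempotents S m = {e \<in> S. m e e = e}"

definition natural_le :: "'s set \<Rightarrow> ('s \<Rightarrow> 's \<Rightarrow> 's) \<Rightarrow> 's \<Rightarrow> 's \<Rightarrow> bool" where
  "natural_le S m s t \<longleftrightarrow> s \<in> S \<and> t \<in> S \<and> (\<exists>e \<in> idempotents S m. s = m e t)"

definition closed_subset :: "'s set \<Rightarrow> ('s \<Rightarrow> 's \<Rightarrow> 's) \<Rightarrow> 's set \<Rightarrow> bool" where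
  "closed_subset S m A \<longleftrightarrow> A \<subseteq> S \<and> (\<forall>a \<in> A. \<forall>s \<in> S. natural_le S m a s \<longrightarrow> s \<in> A)"

definition inverse_subsemigroup ::
    "'s set \<Rightarrow> ('s \<Rightarrow> 's \<Rightarrow> 's) \<Rightarrow> ('s \<Rightarrow> 's) \<Rightarrow> 's set \<Rightarrow> bool" where
  "inverse_subsemigroup S m i A \<longleftrightarrow>
     A \<subseteq> S \<and> A \<noteq> {} \<and> (\<forall>a \<in> A. \<forall>b \<in> A. m a b \<in> A) \<and> (\<forall>a \<in> A. i a \<in> A)"

definition closed_inverse_subsemigroup ::
    "'s set \<Rightarrow> ('s \<Rightarrow> 's \<Rightarrow> 's) \<Rightarrow> ('s \<Rightarrow> 's) \<Rightarrow> 's set \<Rightarrow> bool" where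
  "closed_inverse_subsemigroup S m i A \<longleftrightarrow>
     inverse_subsemigroup S m i A \<and> closed_subset S m A"

definition chain_of_idempotents :: "'s set \<Rightarrow> ('s \<Rightarrow> 's \<Rightarrow> 's) \<Rightarrow> 's set \<Rightarrow> bool" where
  "chain_of_idempotents S m A \<longleftrightarrow>
     A \<subseteq> idempotents S m \<and> (\<forall>a \<in> A. \<forall>b \<in> A. natural_le S m a b \<or> natural_le S m b a)"

definition smallest_closed_inverse_subsemigroup_containing ::
    "'s set \<Rightarrow> ('s \<Rightarrow> 's \<Rightarrow> 's) \<Rightarrow> ('s \<Rightarrow> 's) \<Rightarrow> 's \<Rightarrow> 's set \<Rightarrow> bool" where
  "smallest_closed_inverse_subsemigroup_containing S m i x A \<longleftrightarrow>
     closed_inverse_subsemigroup S m i A \<and> x \<in> A \<and>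
     (\<forall>B. closed_inverse_subsemigroup S m i B \<and> x \<in> B \<longrightarrow> A \<subseteq> B)"


section \<open>Paths\<close>

text \<open>
  A path is its initial vertex together with its list of arcs, so that there is one empty
  path at every vertex. As in \<^theory>\<open>Graph_Theory.Arc_Walk\<close>, loops and parallel arcs are
  allowed.
\<close>

type_synonym ('a, 'b) path = "'a \<times> 'b awalk"

definition src :: "('a, 'b) path \<Rightarrow> 'a" where
  "src u = fst u"

definition tgt :: "('a, 'b) pre_digraph \<Rightarrow> ('a, 'b) path \<Rightarrow> 'a" where
  "tgt G u = pre_digraph.awlast G (fst u) (snd u)"

definition paths :: "('a, 'b) pre_digraph \<Rightarrow> ('a, 'b) path set" where
  "paths G = {u. pre_digraph.awalk G (src u) (snd u) (tgt G u)}"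

text \<open>
  The composite \<open>p \<cdot> v\<close> is meaningful only if \<open>tgt G p = src v\<close>; this is required explicitly
  wherever it is not automatic.
\<close>

definition comp_path :: "('a, 'b) path \<Rightarrow> ('a, 'b) path \<Rightarrow> ('a, 'b) path" (infixr "\<cdot>" 75) where
  "p \<cdot> v = (fst p, snd p @ snd v)"

definition suffix_path ::
    "('a, 'b) pre_digraph \<Rightarrow> ('a, 'b) path \<Rightarrow> ('a, 'b) path \<Rightarrow> bool" where
  "suffix_path G v u \<longleftrightarrow>
     v \<in> paths G \<and> u \<in> paths G \<and> (\<exists>p \<in> paths G. tgt G p = src v \<and> u = p \<cdot> v)"

definition prefix_path ::
    "('a, 'b) pre_digraph \<Rightarrow> ('a, 'b) path \<Rightarrow> ('a, 'b) path \<Rightarrow> bool" where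
  "prefix_path G v u \<longleftrightarrow>
     v \<in> paths G \<and> u \<in> paths G \<and> (\<exists>p \<in> paths G. tgt G v = src p \<and> u = v \<cdot> p)"

definition path_length :: "('a, 'b) path \<Rightarrow> nat" where
  "path_length u = length (snd u)"

definition share_nontrivial_prefix ::
    "('a, 'b) pre_digraph \<Rightarrow> ('a, 'b) path \<Rightarrow> ('a, 'b) path \<Rightarrow> bool" where
  "share_nontrivial_prefix G u v \<longleftrightarrow>
     (\<exists>x \<in> paths G. path_length x > 0 \<and> prefix_path G x u \<and> prefix_path G x v)"

definition directed_circuit :: "('a, 'b) pre_digraph \<Rightarrow> ('a, 'b) path \<Rightarrow> bool" where
  "directed_circuit G p \<longleftrightarrow> p \<in> paths G \<and> path_length p > 0 \<and> src p = tgt G p"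

primrec path_power :: "('a, 'b) path \<Rightarrow> nat \<Rightarrow> ('a, 'b) path" where
  "path_power p 0 = (src p, [])"
| "path_power p (Suc n) = p \<cdot> path_power p n"


section \<open>The graph inverse semigroup\<close>

datatype ('a, 'b) gis = Zero | Elem "('a, 'b) path" "('a, 'b) path"

definition gis_carrier :: "('a, 'b) pre_digraph \<Rightarrow> ('a, 'b) gis set" where
  "gis_carrier G = {Elem v w | v w. v \<in> paths G \<and> w \<in> paths G \<and> src v = src w} \<union> {Zero}"

text \<open>
  \<open>cofactor G u v\<close> is the path \<open>p\<close> with \<open>u = p \<cdot> v\<close>, which is unique if \<open>v\<close> is a suffix of \<open>u\<close>.
\<close>

definition cofactor ::
    "('a, 'b) pre_digraph \<Rightarrow> ('a, 'b) path \<Rightarrow> ('a, 'b) path \<Rightarrow> ('a, 'b) path" where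
  "cofactor G u v = (THE p. p \<in> paths G \<and> tgt G p = src v \<and> u = p \<cdot> v)"

fun gis_mult ::
    "('a, 'b) pre_digraph \<Rightarrow> ('a, 'b) gis \<Rightarrow> ('a, 'b) gis \<Rightarrow> ('a, 'b) gis" where
  "gis_mult G (Elem t u) (Elem v w) =
     (if suffix_path G v u then Elem t (cofactor G u v \<cdot> w)
      else if suffix_path G u v then Elem (cofactor G v u \<cdot> t) w
      else Zero)"
| "gis_mult G Zero y = Zero"
| "gis_mult G x Zero = Zero"

fun gis_inv :: "('a, 'b) gis \<Rightarrow> ('a, 'b) gis" where
  "gis_inv (Elem v w) = Elem w v"
| "gis_inv Zero = Zero"

definition cycle_type ::
    "('a, 'b) pre_digraph \<Rightarrow> ('a, 'b) path \<Rightarrow> ('a, 'b) path \<Rightarrow> ('a, 'b) gis set" where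
  "cycle_type G p q =
     {Elem (v \<cdot> path_power p m \<cdot> q) (v \<cdot> path_power p n \<cdot> q) | v m n. suffix_path G v p} \<union>
     {Elem u u | u. suffix_path G u q}"

definition cycle_data ::
    "('a, 'b) pre_digraph \<Rightarrow> ('a, 'b) path \<Rightarrow> ('a, 'b) path \<Rightarrow> bool" where
  "cycle_data G p q \<longleftrightarrow>
     directed_circuit G p \<and> q \<in> paths G \<and> src q = src p \<and> \<not> share_nontrivial_prefix G p q"

end

theory Submission
  imports Defs "HOL-Library.Sublist"
begin

text \<open>
  Let \<open>L\<close> be closed and proper, so that \<open>0 \<notin> L\<close>. Products of idempotents of \<open>L\<close> are then non-zero,
  which makes the paths \<open>u\<close> with \<open>(u, u) \<in> L\<close> a chain under the suffix order, and the relation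
  \<open>(a, b) \<in> L\<close> is an equivalence on this chain that is stable under extending and stripping
  a common prefix, much like a congruence on the natural numbers. If it is not the identity, its index and
  period give the path \<open>q\<close> and the circuit \<open>p\<close>.

  Conversely, apart from the idempotents given by suffixes of \<open>q\<close>, \<open>cycle_type G p q\<close> consists of the pairs
  \<open>(x \<cdot> q, y \<cdot> q)\<close> where \<open>x\<close>, \<open>y\<close> are suffixes of powers of \<open>p\<close> and \<open>x \<cdot> p\<^sup>i = y \<cdot> p\<^sup>j\<close> for some
  \<open>i\<close>, \<open>j\<close>. In this form closure under products is a matter of commuting powers of \<open>p\<close>, and closure
  under the natural order is where the absence of a common prefix of \<open>p\<close> and \<open>q\<close> is needed.
\<close>

declare gis_mult.simps(1) [simp del] split_paired_Ex [simp del] split_paired_All [simp del]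

section \<open>Composition, length and powers of paths\<close>

lemma path_length_comp [simp]: "path_length (u \<cdot> v) = path_length u + path_length v"
  by (simp add: path_length_def comp_path_def)

lemma src_comp [simp]: "src (u \<cdot> v) = src u"
  by (simp add: src_def comp_path_def)

lemma src_Pair [simp]: "src (x, as) = x"
  by (simp add: src_def)

lemma comp_assoc: "(u \<cdot> v) \<cdot> w = u \<cdot> v \<cdot> w"
  by (simp add: comp_path_def)

lemma comp_empty [simp]:
  "u \<cdot> (x, []) = u" "src u = x \<Longrightarrow> (x, []) \<cdot> u = u"
  by (auto simp: comp_path_def src_def)

lemma src_power [simp]: "src (path_power p n) = src p"
  by (cases n) (simp_all add: src_def comp_path_def)

lemma path_length_power [simp]: "path_length (path_power p n) = n * path_length p"
  by (induction n) (simp_all add: path_length_def comp_path_def)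

lemma path_power_add: "path_power p (m + n) = path_power p m \<cdot> path_power p n"
  by (induction m) (simp_all add: comp_assoc)

lemma path_power_comm: "path_power p n \<cdot> p = p \<cdot> path_power p n"
  by (induction n) (simp_all add: comp_assoc)

section \<open>Paths and the suffix order in a digraph\<close>

context wf_digraph
begin

lemma paths_iff:
  "u \<in> paths G \<longleftrightarrow> src u \<in> verts G \<and> set (snd u) \<subseteq> arcs G \<and> cas (src u) (snd u) (tgt G u)"
  by (simp add: paths_def awalk_def)

lemma tgt_comp: "tgt G u = src v \<Longrightarrow> tgt G (u \<cdot> v) = tgt G v"
  by (simp add: tgt_def src_def comp_path_def awlast_append)

lemma comp_in_paths:
  "u \<in> paths G \<Longrightarrow> v \<in> paths G \<Longrightarrow> tgt G u = src v \<Longrightarrow> u \<cdot> v \<in> paths G"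
  unfolding paths_def
  by (auto simp: tgt_comp comp_path_def src_def tgt_def awlast_append)

lemma tgt_empty [simp]: "tgt G (x, []) = x"
  by (simp add: tgt_def)

lemma empty_in_paths: "u \<in> paths G \<Longrightarrow> (src u, []) \<in> paths G"
  by (auto simp: paths_def src_def awalk_Nil_iff intro: awalk_hd_in_verts)

lemma path_append_in_paths:
  assumes "(x, as @ bs) \<in> paths G"
  shows "(x, as) \<in> paths G" "(awlast x as, bs) \<in> paths G" "tgt G (x, as) = awlast x as"
    "tgt G (awlast x as, bs) = tgt G (x, as @ bs)"
  using assms by (auto simp: paths_def src_def tgt_def awlast_append)

lemma src_tail: "u \<in> paths G \<Longrightarrow> snd u \<noteq> [] \<Longrightarrow> src u = tail G (hd (snd u))"
  by (cases "snd u") (auto simp: paths_iff)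

text \<open>The first arc of a non-empty path fixes its source; an empty path starts where it
  ends.\<close>

lemma path_eqI:
  assumes "u \<in> paths G" "v \<in> paths G" "tgt G u = tgt G v" "snd u = snd v"
  shows "u = v"
proof (cases "snd u = []")
  case True
  then show ?thesis using assms by (cases u; cases v) (simp add: tgt_def)
next
  case False
  then have "src u = src v" using assms src_tail by metis
  then show ?thesis using assms by (cases u; cases v) (simp add: src_def)
qed

text \<open>Reduces suffixes of paths to suffixes of lists, whose order properties are available.
  Equality of targets fixes the vertex of an empty \<open>v\<close>, about which the arc list says
  nothing.\<close>

lemma suffix_path_iff:
  "suffix_path G v u \<longleftrightarrow>
     v \<in> paths G \<and> u \<in> paths G \<and> tgt G v = tgt G u \<and> suffix (snd v) (snd u)"
proof safe
  assume vu: "v \<in> paths G" "u \<in> paths G" "tgt G v = tgt G u" "suffix (snd v) (snd u)"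
  then obtain as where as: "snd u = as @ snd v" by (auto simp: suffix_def)
  let ?p = "(src u, as)"
  have u: "u = (src u, as @ snd v)" using as by (metis prod.collapse src_def)
  note app = path_append_in_paths[of "src u" as "snd v", folded u, OF vu(2)]
  \<comment> \<open>Same arcs and same target, hence same source by \<open>path_eqI\<close>; so the
    remaining initial part of \<open>u\<close> ends where \<open>v\<close> starts.\<close>
  have "(awlast (src u) as, snd v) = v"
    using app vu by (intro path_eqI) auto
  then have "tgt G ?p = src v" using app(3) by (metis fst_conv src_def)
  moreover have "u = ?p \<cdot> v" using u by (simp add: comp_path_def)
  ultimately show "suffix_path G v u" using vu app(1) unfolding suffix_path_def by blast
qed (auto simp: suffix_path_def tgt_comp, auto simp: comp_path_def suffix_def)

lemma suffix_path_compI: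
  "c \<in> paths G \<Longrightarrow> v \<in> paths G \<Longrightarrow> tgt G c = src v \<Longrightarrow> suffix_path G v (c \<cdot> v)"
  by (auto simp: suffix_path_def comp_in_paths)

lemma suffix_pathE:
  assumes "suffix_path G v u"
  obtains c where "c \<in> paths G" "v \<in> paths G" "tgt G c = src v" "u = c \<cdot> v"
  using assms by (auto simp: suffix_path_def)

lemma suffix_path_refl: "u \<in> paths G \<Longrightarrow> suffix_path G u u"
  by (simp add: suffix_path_iff)

lemma suffix_path_trans: "suffix_path G u v \<Longrightarrow> suffix_path G v w \<Longrightarrow> suffix_path G u w"
  by (auto simp: suffix_path_iff intro: suffix_order.trans)

lemma suffix_path_linear:
  "suffix_path G u w \<Longrightarrow> suffix_path G v w \<Longrightarrow> suffix_path G u v \<or> suffix_path G v u"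
  by (auto simp: suffix_path_iff dest: suffix_same_cases)

lemma suffix_path_length: "suffix_path G u v \<Longrightarrow> path_length u \<le> path_length v"
  by (auto elim!: suffix_pathE)

lemma suffix_path_same_length:
  "suffix_path G u v \<Longrightarrow> path_length u = path_length v \<Longrightarrow> u = v"
  by (auto simp: suffix_path_iff path_length_def suffix_def intro: path_eqI)

lemma cofactor_comp:
  assumes "c \<in> paths G" "tgt G c = src v"
  shows "cofactor G (c \<cdot> v) v = c"
  unfolding cofactor_def
proof (rule the_equality)
  fix d assume "d \<in> paths G \<and> tgt G d = src v \<and> c \<cdot> v = d \<cdot> v"
  then show "d = c" by (auto simp: comp_path_def prod_eq_iff)
qed (use assms in auto)

section \<open>Products, idempotents and natural order of the graph inverse semigroup\<close>

lemma carrier_Elem [simp]: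
  "Elem u v \<in> gis_carrier G \<longleftrightarrow> u \<in> paths G \<and> v \<in> paths G \<and> src u = src v"
  by (simp add: gis_carrier_def)

lemma Zero_in_carrier [simp]: "Zero \<in> gis_carrier G"
  by (simp add: gis_carrier_def)

lemma mult_Elem_left:
  assumes "c \<in> paths G" "v \<in> paths G" "tgt G c = src v"
  shows "gis_mult G (Elem t (c \<cdot> v)) (Elem v w) = Elem t (c \<cdot> w)"
  using assms by (simp add: gis_mult.simps(1) cofactor_comp suffix_path_compI)

lemma mult_Elem_right:
  assumes "c \<in> paths G" "Elem t u \<in> gis_carrier G" "tgt G c = src u" "src w = src c"
  shows "gis_mult G (Elem t u) (Elem (c \<cdot> u) w) = Elem (c \<cdot> t) w"
proof (cases "suffix_path G (c \<cdot> u) u")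
  \<comment> \<open>Here the first clause of \<open>gis_mult\<close> applies. Comparing lengths,
    \<open>c\<close> is empty, and then both clauses give the same product.\<close>
  case True
  then have "path_length c = 0" using suffix_path_length by fastforce
  then have c: "c = (src u, [])" using assms
    by (cases c) (simp add: path_length_def)
  then have "cofactor G u u = (src u, [])" using cofactor_comp[of c u] assms by simp
  with c True show ?thesis using assms by (simp add: gis_mult.simps(1))
next
  case False
  then show ?thesis using assms by (simp add: gis_mult.simps(1) cofactor_comp suffix_path_compI)
qed

text \<open>If one component is \<open>c\<close> followed by the other, squaring puts a further
  \<open>c\<close> in front of it, so idempotency forces \<open>c\<close> to be empty. Incomparable
  components give the square \<open>Zero\<close>.\<close>

lemma idempotents_gis:
  "idempotents (gis_carrier G) (gis_mult G) = {Elem u u | u. u \<in> paths G} \<union> {Zero}"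
proof -
  have "t = u" if tu: "Elem t u \<in> gis_carrier G" "gis_mult G (Elem t u) (Elem t u) = Elem t u" for t u
  proof (cases "suffix_path G t u")
    case True
    then obtain c where c: "c \<in> paths G" "t \<in> paths G" "tgt G c = src t" "u = c \<cdot> t" by (rule suffix_pathE)
    then have "c \<cdot> u = u" using mult_Elem_left[of c t t u] tu by simp
    then have "snd c = []" by (metis comp_path_def append_self_conv2 snd_conv)
    with c show ?thesis by (cases c) simp
  next
    case False
    then have "suffix_path G u t" using tu by (auto simp: gis_mult.simps(1) split: if_splits)
    then obtain c where c: "c \<in> paths G" "u \<in> paths G" "tgt G c = src u" "t = c \<cdot> u" by (rule suffix_pathE)
    then have "c \<cdot> t = t" using mult_Elem_right[of c t u u] tu by simp
    then have "snd c = []" by (metis comp_path_def append_self_conv2 snd_conv)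
    with c show ?thesis by (cases c) simp
  qed
  moreover have "gis_mult G (Elem u u) (Elem u u) = Elem u u" if "u \<in> paths G" for u
    using mult_Elem_left[of "(src u, [])" u u u] empty_in_paths[OF that] that by simp
  ultimately show ?thesis
    unfolding idempotents_def by (intro set_eqI, case_tac x) auto
qed

text \<open>Multiplying \<open>Elem s t\<close> by \<open>Elem u u\<close> from the left puts
  \<open>c\<close> in front of both components if \<open>u = c \<cdot> s\<close>, and changes
  nothing if \<open>u\<close> is a suffix of \<open>s\<close>, which is the case of an empty
  \<open>c\<close>. Conversely \<open>Elem a a\<close> serves as the idempotent.\<close>

lemma natural_le_Elem:
  assumes "Elem a b \<in> gis_carrier G"
  shows "natural_le (gis_carrier G) (gis_mult G) (Elem a b) x \<longleftrightarrow>
    (\<exists>c s t. x = Elem s t \<and> x \<in> gis_carrier G \<and> c \<in> paths G \<and> tgt G c = src s \<and> a = c \<cdot> s \<and> b = c \<cdot> t)"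
    (is "?L \<longleftrightarrow> ?R")
proof
  assume ?L
  then obtain u where x: "x \<in> gis_carrier G" and u: "u \<in> paths G" and eq: "Elem a b = gis_mult G (Elem u u) x"
    by (auto simp: natural_le_def idempotents_gis)
  then obtain s t where st: "x = Elem s t" by (cases x) auto
  show ?R
  proof (cases "suffix_path G s u")
    case True
    then obtain c where c: "c \<in> paths G" "s \<in> paths G" "tgt G c = src s" "u = c \<cdot> s" by (rule suffix_pathE)
    then show ?thesis using mult_Elem_left[of c s u t] eq x st by auto
  next
    case False
    then have "suffix_path G u s" using eq st by (auto simp: gis_mult.simps(1) split: if_splits)
    then obtain c where c: "c \<in> paths G" "u \<in> paths G" "tgt G c = src u" "s = c \<cdot> u" by (rule suffix_pathE)
    then have "a = s" "b = t" using mult_Elem_right[of c u u t] eq st x by auto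
    then show ?thesis using st x empty_in_paths[of s]
      by (intro exI[of _ "(src s, [])"] exI[of _ s] exI[of _ t]) auto
  qed
next
  assume ?R
  then obtain c s t where *: "x = Elem s t" "x \<in> gis_carrier G" "c \<in> paths G" "tgt G c = src s" "a = c \<cdot> s" "b = c \<cdot> t"
    by blast
  then have "gis_mult G (Elem a a) x = Elem a b" using mult_Elem_left[of c s a t] by simp
  then show ?L
    using assms * unfolding natural_le_def idempotents_gis
    by (intro conjI bexI[of _ "Elem a a"]) auto
qed

lemma natural_le_Zero: "x \<in> gis_carrier G \<Longrightarrow> natural_le (gis_carrier G) (gis_mult G) Zero x"
  unfolding natural_le_def idempotents_gis by (intro conjI bexI[of _ Zero]) auto

section \<open>Cancellation in equations between paths\<close>

lemma suffix_path_comp_cancel: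
  assumes "suffix_path G (u \<cdot> w) (v \<cdot> w)" "u \<in> paths G" "v \<in> paths G"
    "tgt G u = src w" "tgt G v = src w"
  shows "suffix_path G u v"
proof -
  have "suffix (snd u) (snd v)"
    using assms(1) by (auto simp: suffix_path_iff comp_path_def suffix_def)
  then show ?thesis using assms by (simp add: suffix_path_iff)
qed

lemma comp_left_cancel:
  "c \<cdot> u = c \<cdot> v \<Longrightarrow> src u = src v \<Longrightarrow> u = v"
  by (simp add: comp_path_def src_def prod_eq_iff)

lemma comp_right_cancel: "u \<cdot> c = v \<cdot> c \<Longrightarrow> u = v"
  by (simp add: comp_path_def prod_eq_iff)

lemma path_length_0: "path_length u = 0 \<Longrightarrow> u = (src u, [])"
  by (cases u) (simp add: path_length_def)

text \<open>Levi's lemma for paths: \<open>v\<close> and \<open>y\<close> are suffixes of the same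
  path, hence comparable, and the lengths decide which one is the shorter.\<close>

lemma comp_eq_comp:
  assumes "u \<cdot> v = x \<cdot> y" and u: "u \<in> paths G" "v \<in> paths G" "tgt G u = src v"
    and x: "x \<in> paths G" "y \<in> paths G" "tgt G x = src y" and "path_length u \<le> path_length x"
  obtains e where "e \<in> paths G" "tgt G u = src e" "tgt G e = src y" "x = u \<cdot> e" "v = e \<cdot> y"
proof -
  have "suffix_path G v (x \<cdot> y)" "suffix_path G y (x \<cdot> y)"
    using suffix_path_compI[OF u] suffix_path_compI[OF x] assms(1) by simp_all
  then have "suffix_path G y v \<or> suffix_path G v y" by (metis suffix_path_linear)
  moreover have len: "path_length y \<le> path_length v"
    using arg_cong[OF assms(1), of path_length] assms(8) by simp
  ultimately have "suffix_path G y v"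
    using suffix_path_length[of v y] suffix_path_same_length[of v y] suffix_path_refl[OF x(2)] by auto
  then obtain e where e: "e \<in> paths G" "tgt G e = src y" "v = e \<cdot> y" by (rule suffix_pathE)
  then have "x \<cdot> y = (u \<cdot> e) \<cdot> y" using assms(1) by (simp add: comp_assoc)
  then have "x = u \<cdot> e" by (rule comp_right_cancel)
  moreover have "tgt G u = src e" using u(3) e(3) by simp
  ultimately show ?thesis using that e by blast
qed

text \<open>\<open>Zero\<close> lies below every element, so upward closure yields the whole
  carrier.\<close>

lemma Zero_in_closed:
  assumes "closed_inverse_subsemigroup (gis_carrier G) (gis_mult G) gis_inv L" "Zero \<in> L"
  shows "L = gis_carrier G"
  using assms natural_le_Zero
  unfolding closed_inverse_subsemigroup_def closed_subset_def inverse_subsemigroup_def by blast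

end

section \<open>Closed inverse subsemigroups without zero, read as relations on paths\<close>

locale zero_free_closed = wf_digraph G for G :: "('a, 'b) pre_digraph" +
  fixes L :: "('a, 'b) gis set"
  assumes closed: "closed_inverse_subsemigroup (gis_carrier G) (gis_mult G) gis_inv L"
    and Zero_notin: "Zero \<notin> L"
begin

lemma in_paths:
  assumes "Elem a b \<in> L" shows "a \<in> paths G" "b \<in> paths G" "src a = src b"
proof -
  have "Elem a b \<in> gis_carrier G"
    using closed assms by (auto simp: closed_inverse_subsemigroup_def inverse_subsemigroup_def)
  then show "a \<in> paths G" "b \<in> paths G" "src a = src b" by simp_all
qed

lemma mult_closed: "x \<in> L \<Longrightarrow> y \<in> L \<Longrightarrow> gis_mult G x y \<in> L"
  using closed by (auto simp: closed_inverse_subsemigroup_def inverse_subsemigroup_def)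

lemma Elem_sym: "Elem a b \<in> L \<Longrightarrow> Elem b a \<in> L"
  using closed by (force simp: closed_inverse_subsemigroup_def inverse_subsemigroup_def)

text \<open>The product of \<open>Elem a b\<close> and \<open>Elem b c\<close> has an empty
  cofactor. Together with inverses this makes membership in \<open>L\<close> a partial equivalence
  on paths.\<close>

lemma Elem_trans: "Elem a b \<in> L \<Longrightarrow> Elem b c \<in> L \<Longrightarrow> Elem a c \<in> L"
  using mult_closed[of "Elem a b" "Elem b c"] mult_Elem_left[of "(src b, [])" b a c]
    in_paths[of a b] in_paths[of b c] empty_in_paths[of b] by simp

lemma Elem_refl: "Elem a b \<in> L \<Longrightarrow> Elem a a \<in> L" "Elem a b \<in> L \<Longrightarrow> Elem b b \<in> L"
  using Elem_trans Elem_sym by blast+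

text \<open>For incomparable paths the product of the two idempotents would be \<open>Zero\<close>.
  Hence the diagonal paths form a chain, in which length identifies a path.\<close>

lemma linear:
  assumes "Elem a a \<in> L" "Elem b b \<in> L"
  shows "suffix_path G a b \<or> suffix_path G b a"
  using mult_closed[OF assms] Zero_notin by (auto simp: gis_mult.simps(1) split: if_splits)

lemma eq_of_length:
  "Elem a a \<in> L \<Longrightarrow> Elem b b \<in> L \<Longrightarrow> path_length a = path_length b \<Longrightarrow> a = b"
  using linear suffix_path_same_length by metis

lemma suffix_of_length:
  "Elem a a \<in> L \<Longrightarrow> Elem b b \<in> L \<Longrightarrow> path_length a \<le> path_length b \<Longrightarrow> suffix_path G a b"
  using linear[of a b] suffix_path_length[of b a] suffix_path_same_length[of b a] by force

text \<open>Removing a common prefix moves upwards in the natural order, so this is where closedness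
  enters.\<close>

lemma Elem_cancel:
  assumes "Elem (c \<cdot> a) (c \<cdot> b) \<in> L" "c \<in> paths G" "a \<in> paths G" "b \<in> paths G"
    "tgt G c = src a" "src b = src a"
  shows "Elem a b \<in> L"
proof -
  have "natural_le (gis_carrier G) (gis_mult G) (Elem (c \<cdot> a) (c \<cdot> b)) (Elem a b)"
    using assms by (subst natural_le_Elem) (auto simp: comp_in_paths)
  moreover have "Elem a b \<in> gis_carrier G" using assms by simp
  ultimately show ?thesis
    using closed assms(1) unfolding closed_inverse_subsemigroup_def closed_subset_def by blast
qed

lemma Elem_suffix: "Elem u u \<in> L \<Longrightarrow> suffix_path G v u \<Longrightarrow> Elem v v \<in> L"
  by (erule suffix_pathE) (auto intro: Elem_cancel)

text \<open>Multiply the idempotent at \<open>c \<cdot> a\<close> by \<open>Elem a b\<close>. A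
  prefix can thus be added whenever the extended path is still on the diagonal.\<close>

lemma Elem_extend:
  assumes "Elem (c \<cdot> a) (c \<cdot> a) \<in> L" "Elem a b \<in> L" "c \<in> paths G" "tgt G c = src a"
  shows "Elem (c \<cdot> a) (c \<cdot> b) \<in> L"
  using mult_closed[OF assms(1,2)] mult_Elem_left[of c a "c \<cdot> a" b] in_paths[OF assms(2)] assms by simp

end

section \<open>Suffixes of powers of a circuit, and their comparison up to trailing powers\<close>

locale cycle = wf_digraph G for G :: "('a, 'b) pre_digraph" +
  fixes p q :: "('a, 'b) path"
  assumes cycle: "cycle_data G p q"
begin

lemma p: "p \<in> paths G" "tgt G p = src p" "path_length p > 0"
  and q: "q \<in> paths G" "src q = src p"
  using cycle by (auto simp: cycle_data_def directed_circuit_def)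

abbreviation pw :: "nat \<Rightarrow> ('a, 'b) path" where "pw \<equiv> path_power p"

lemma pw: "pw n \<in> paths G" "tgt G (pw n) = src p"
  by (induction n) (simp_all add: empty_in_paths[OF p(1)] p comp_in_paths tgt_comp)

text \<open>These are the finite suffixes of the left-infinite path \<open>...ppp\<close>, expressed
  through finite powers.\<close>

definition power_suffixes :: "('a, 'b) path set" where
  "power_suffixes = {x. \<exists>n. suffix_path G x (pw n)}"

lemma power_suffix:
  assumes "x \<in> power_suffixes" shows "x \<in> paths G" "tgt G x = src p"
  using assms by (auto simp: power_suffixes_def suffix_path_iff pw)

text \<open>Smaller powers are suffixes of larger ones. This lets two elements be placed in a common
  power, and the power be chosen large enough for cancellation.\<close>

lemma power_suffix_ge:
  assumes "x \<in> power_suffixes" obtains n where "\<And>m. n \<le> m \<Longrightarrow> suffix_path G x (pw m)"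
proof -
  obtain n where n: "suffix_path G x (pw n)" using assms by (auto simp: power_suffixes_def)
  have "suffix_path G (pw n) (pw m)" if "n \<le> m" for m
    using suffix_path_compI[of "pw (m - n)" "pw n"] that pw
    by (simp flip: path_power_add)
  then show ?thesis using n that suffix_path_trans by blast
qed

lemma power_suffix_linear:
  assumes "x \<in> power_suffixes" "y \<in> power_suffixes"
  shows "suffix_path G x y \<or> suffix_path G y x"
proof -
  obtain m n where "\<And>k. m \<le> k \<Longrightarrow> suffix_path G x (pw k)" "\<And>k. n \<le> k \<Longrightarrow> suffix_path G y (pw k)"
    using power_suffix_ge assms by metis
  then have "suffix_path G x (pw (max m n))" "suffix_path G y (pw (max m n))" by simp_all
  then show ?thesis by (rule suffix_path_linear)
qed

lemma power_suffix_suffix: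
  "x \<in> power_suffixes \<Longrightarrow> suffix_path G y x \<Longrightarrow> y \<in> power_suffixes"
  by (auto simp: power_suffixes_def intro: suffix_path_trans)

lemma pw_in_power_suffixes [simp]: "pw n \<in> power_suffixes"
  using suffix_path_refl[OF pw(1)] by (auto simp: power_suffixes_def)

lemma p_in_power_suffixes: "p \<in> power_suffixes"
  using pw_in_power_suffixes[of 1] by simp

lemma power_suffix_comp_pw:
  assumes "x \<in> power_suffixes" shows "x \<cdot> pw n \<in> power_suffixes"
proof -
  obtain m where m: "suffix_path G x (pw m)" using assms by (auto simp: power_suffixes_def)
  then obtain c where c: "c \<in> paths G" "x \<in> paths G" "tgt G c = src x" "pw m = c \<cdot> x" by (rule suffix_pathE)
  have "suffix_path G (x \<cdot> pw n) (c \<cdot> x \<cdot> pw n)"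
    using c power_suffix[OF assms] pw by (intro suffix_path_compI) (auto intro: comp_in_paths)
  also have "c \<cdot> x \<cdot> pw n = pw (m + n)" by (simp add: path_power_add c(4) comp_assoc)
  finally show ?thesis by (auto simp: power_suffixes_def)
qed

lemma power_suffix_comp_pw_cancel:
  assumes "x \<cdot> pw n \<in> power_suffixes" "x \<in> paths G" "tgt G x = src p"
  shows "x \<in> power_suffixes"
proof -
  obtain m where "\<And>k. m \<le> k \<Longrightarrow> suffix_path G (x \<cdot> pw n) (pw k)"
    using power_suffix_ge assms by metis
  then have "suffix_path G (x \<cdot> pw n) (pw m \<cdot> pw n)" by (simp flip: path_power_add)
  then have "suffix_path G x (pw m)"
    by (rule suffix_path_comp_cancel) (simp_all add: assms pw)
  then show ?thesis by (auto simp: power_suffixes_def)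
qed

text \<open>Division with remainder by \<open>p\<close>: copies of \<open>p\<close> are stripped
  from the right end until less than a full copy remains. A stripped copy is moved to the front of
  the power by \<open>path_power_comm\<close>.\<close>

lemma power_suffix_decomp:
  assumes "x \<in> power_suffixes"
  shows "\<exists>v n. x = v \<cdot> pw n \<and> suffix_path G v p \<and> path_length v < path_length p"
  using assms
proof (induction "path_length x" arbitrary: x rule: less_induct)
  case less
  note x = power_suffix[OF less.prems]
  show ?case
  proof (cases "path_length x < path_length p")
    case True
    then have "suffix_path G x p"
      using power_suffix_linear[OF less.prems p_in_power_suffixes] suffix_path_length[of p x] by auto
    moreover have "x = x \<cdot> pw 0" by simp
    ultimately show ?thesis using True by blast
  next
    case False
    then have "suffix_path G p x"
      using power_suffix_linear[OF less.prems p_in_power_suffixes] suffix_path_length[of x p]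
        suffix_path_same_length[of x p] by force
    then obtain y where y: "y \<in> paths G" "tgt G y = src p" "x = y \<cdot> p" by (auto elim: suffix_pathE)
    then have "y \<in> power_suffixes" using power_suffix_comp_pw_cancel[of y 1] less.prems by simp
    moreover have "path_length y < path_length x" using y p by simp
    ultimately obtain v n where "y = v \<cdot> pw n" "suffix_path G v p" "path_length v < path_length p"
      using less.hyps by blast
    then show ?thesis using y
      by (intro exI[of _ v] exI[of _ "Suc n"]) (simp add: comp_assoc path_power_comm)
  qed
qed

text \<open>Allowing a power on both sides makes symmetry immediate and reduces transitivity to
  commuting powers; \<open>rel_iff\<close> recovers the one-sided form.\<close>

definition rel :: "('a, 'b) path \<Rightarrow> ('a, 'b) path \<Rightarrow> bool" where
  "rel x y \<longleftrightarrow> x \<in> power_suffixes \<and> y \<in> power_suffixes \<and> (\<exists>i j. x \<cdot> pw i = y \<cdot> pw j)"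

lemma rel_sym: "rel x y \<Longrightarrow> rel y x"
  unfolding rel_def by (blast intro: sym)

lemma rel_trans:
  assumes "rel x y" "rel y z" shows "rel x z"
proof -
  obtain i j k l where ij: "x \<cdot> pw i = y \<cdot> pw j" and kl: "y \<cdot> pw k = z \<cdot> pw l"
    using assms by (auto simp: rel_def)
  have "x \<cdot> pw (i + k) = (x \<cdot> pw i) \<cdot> pw k" by (simp add: path_power_add comp_assoc)
  also have "\<dots> = y \<cdot> pw (j + k)" by (simp add: ij path_power_add comp_assoc)
  also have "\<dots> = (y \<cdot> pw k) \<cdot> pw j" by (subst add.commute) (simp add: path_power_add comp_assoc)
  also have "\<dots> = z \<cdot> pw (l + j)" by (simp add: kl path_power_add comp_assoc)
  finally have "x \<cdot> pw (i + k) = z \<cdot> pw (l + j)" .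
  then show ?thesis using assms unfolding rel_def by blast
qed

lemma rel_src:
  assumes "rel x y" shows "src x = src y"
proof -
  obtain i j where "x \<cdot> pw i = y \<cdot> pw j" using assms by (auto simp: rel_def)
  from arg_cong[OF this, of src] show ?thesis by simp
qed

text \<open>That \<open>c \<cdot> y\<close> is again a power suffix follows from
  \<open>c \<cdot> y \<cdot> pw j = c \<cdot> x \<cdot> pw i\<close> by cancelling the trailing
  power.\<close>

lemma rel_shift:
  assumes xy: "rel x y" and c: "c \<in> paths G" "tgt G c = src x" "c \<cdot> x \<in> power_suffixes"
  shows "rel (c \<cdot> x) (c \<cdot> y)"
proof -
  obtain i j where ij: "x \<cdot> pw i = y \<cdot> pw j" using xy by (auto simp: rel_def)
  then have eq: "(c \<cdot> x) \<cdot> pw i = (c \<cdot> y) \<cdot> pw j" by (simp add: comp_assoc)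
  have y: "y \<in> paths G" "tgt G y = src p" using xy power_suffix by (auto simp: rel_def)
  have "(c \<cdot> y) \<cdot> pw j \<in> power_suffixes" using power_suffix_comp_pw[OF c(3), of i] eq by simp
  then have "c \<cdot> y \<in> power_suffixes"
    by (rule power_suffix_comp_pw_cancel) (use c y rel_src[OF xy] in \<open>simp_all add: comp_in_paths tgt_comp\<close>)
  then show ?thesis using c(3) eq unfolding rel_def by blast
qed

text \<open>Cancel the smaller of the two powers on the right.\<close>

lemma rel_iff:
  assumes "rel x y" shows "\<exists>n. x = y \<cdot> pw n \<or> y = x \<cdot> pw n"
proof -
  obtain i j where ij: "x \<cdot> pw i = y \<cdot> pw j" using assms by (auto simp: rel_def)
  show ?thesis
  proof (cases "i \<le> j")
    case True
    then have "x \<cdot> pw i = (y \<cdot> pw (j - i)) \<cdot> pw i" using ij by (simp add: comp_assoc flip: path_power_add)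
    then have "x = y \<cdot> pw (j - i)" by (rule comp_right_cancel)
    then show ?thesis by blast
  next
    case False
    then have "(x \<cdot> pw (i - j)) \<cdot> pw j = y \<cdot> pw j" using ij by (simp add: comp_assoc flip: path_power_add)
    then have "x \<cdot> pw (i - j) = y" by (rule comp_right_cancel)
    then show ?thesis by auto
  qed
qed

text \<open>One inclusion holds because powers of \<open>p\<close> commute. For the other,
  \<open>rel_iff\<close> makes one path an extension of the other by a power; dividing the shorter
  one by \<open>p\<close> gives a remainder \<open>v\<close> that serves both.\<close>

lemma cycle_type_eq:
  "cycle_type G p q = {Elem (x \<cdot> q) (y \<cdot> q) | x y. rel x y} \<union> {Elem u u | u. suffix_path G u q}"
proof -
  have 1: "rel (v \<cdot> pw m) (v \<cdot> pw n)" if "suffix_path G v p" for v m n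
  proof -
    have "v \<in> power_suffixes" using that p_in_power_suffixes power_suffix_suffix by blast
    moreover have "(v \<cdot> pw m) \<cdot> pw n = (v \<cdot> pw n) \<cdot> pw m"
      by (simp add: comp_assoc add.commute flip: path_power_add)
    ultimately show ?thesis by (auto simp: rel_def power_suffix_comp_pw)
  qed
  have 2: "\<exists>v m n. suffix_path G v p \<and> x = v \<cdot> pw m \<and> y = v \<cdot> pw n" if "rel x y" for x y
  proof -
    obtain r where r: "x = y \<cdot> pw r \<or> y = x \<cdot> pw r" using rel_iff[OF \<open>rel x y\<close>] by blast
    obtain v m where v: "x = v \<cdot> pw m" "suffix_path G v p"
      using power_suffix_decomp[of x] \<open>rel x y\<close> unfolding rel_def by blast
    obtain w n where w: "y = w \<cdot> pw n" "suffix_path G w p"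
      using power_suffix_decomp[of y] \<open>rel x y\<close> unfolding rel_def by blast
    from r show ?thesis
    proof
      assume "x = y \<cdot> pw r"
      then have "x = w \<cdot> pw (n + r)" using w by (simp add: comp_assoc path_power_add)
      then show ?thesis using w by blast
    next
      assume "y = x \<cdot> pw r"
      then have "y = v \<cdot> pw (m + r)" using v by (simp add: comp_assoc path_power_add)
      then show ?thesis using v by blast
    qed
  qed
  have "{Elem (v \<cdot> pw m \<cdot> q) (v \<cdot> pw n \<cdot> q) | v m n. suffix_path G v p} =
    {Elem (x \<cdot> q) (y \<cdot> q) | x y. rel x y}" (is "?A = ?B")
  proof
    show "?A \<subseteq> ?B"
    proof
      fix z assume "z \<in> ?A"
      then obtain v m n where "suffix_path G v p" "z = Elem (v \<cdot> pw m \<cdot> q) (v \<cdot> pw n \<cdot> q)" by blast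
      then have "rel (v \<cdot> pw m) (v \<cdot> pw n)" "z = Elem ((v \<cdot> pw m) \<cdot> q) ((v \<cdot> pw n) \<cdot> q)"
        using 1 by (simp_all add: comp_assoc)
      then show "z \<in> ?B" by blast
    qed
    show "?B \<subseteq> ?A"
    proof
      fix z assume "z \<in> ?B"
      then obtain x y where "rel x y" and z: "z = Elem (x \<cdot> q) (y \<cdot> q)" by blast
      then obtain v m n where "suffix_path G v p" "x = v \<cdot> pw m" "y = v \<cdot> pw n" using 2 by blast
      then have "suffix_path G v p \<and> z = Elem (v \<cdot> pw m \<cdot> q) (v \<cdot> pw n \<cdot> q)" using z by (simp add: comp_assoc)
      then show "z \<in> ?A" by blast
    qed
  qed
  then show ?thesis unfolding cycle_type_def by simp
qed

text \<open>The power is positive, so it begins with \<open>p\<close>. A non-empty \<open>c\<close>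
  would make its first arc a common first arc of \<open>p\<close> and \<open>q\<close>, and this arc
  alone is a forbidden common prefix.\<close>

lemma no_shared_prefix:
  assumes "q = c \<cdot> a" "pw (Suc n) \<cdot> q = c \<cdot> b"
  shows "path_length c = 0"
proof (rule ccontr)
  assume "path_length c \<noteq> 0"
  then obtain e es where e: "snd c = e # es" by (cases "snd c") (auto simp: path_length_def)
  obtain f fs where f: "snd p = f # fs" using p(3) by (cases "snd p") (auto simp: path_length_def)
  have ef: "e = f" using arg_cong[OF assms(2), of snd] e f by (simp add: comp_path_def)
  let ?x = "(src p, [e])"
  have P: "p = (src p, [e] @ fs)" using f ef by (cases p) simp
  have Q: "q = (src p, [e] @ (es @ snd a))"
    using arg_cong[OF assms(1), of snd] e q(2) by (cases q) (simp add: comp_path_def)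
  have *: "?x \<in> paths G" "prefix_path G ?x u" if u: "u = (src p, [e] @ bs)" "u \<in> paths G" for u bs
  proof -
    let ?y = "(awlast (src p) [e], bs)"
    note app = path_append_in_paths[of "src p" "[e]" bs, folded u(1), OF u(2)]
    show "?x \<in> paths G" by (rule app)
    moreover have "u = ?x \<cdot> ?y" by (simp add: u(1) comp_path_def)
    ultimately show "prefix_path G ?x u"
      unfolding prefix_path_def using u(2) app(2,3) by (intro conjI bexI[of _ ?y]) simp_all
  qed
  have "share_nontrivial_prefix G p q"
    unfolding share_nontrivial_prefix_def using *[OF P p(1)] *[OF Q q(1)]
    by (intro bexI[of _ ?x]) (simp_all add: path_length_def)
  then show False using cycle by (simp add: cycle_data_def)
qed

section \<open>Cycle type sets are closed inverse subsemigroups\<close>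

lemma rel_power_suffix: "rel x y \<Longrightarrow> x \<in> power_suffixes" "rel x y \<Longrightarrow> y \<in> power_suffixes"
  by (auto simp: rel_def)

lemma rel_refl: "x \<in> power_suffixes \<Longrightarrow> rel x x"
  unfolding rel_def by auto

lemma power_suffix_comp_q:
  "x \<in> power_suffixes \<Longrightarrow> x \<cdot> q \<in> paths G"
  using power_suffix q by (simp add: comp_in_paths)

lemma rel_in_cycle_type: "rel x y \<Longrightarrow> Elem (x \<cdot> q) (y \<cdot> q) \<in> cycle_type G p q"
  unfolding cycle_type_eq by blast

lemma suffix_in_cycle_type: "suffix_path G u q \<Longrightarrow> Elem u u \<in> cycle_type G p q"
  unfolding cycle_type_eq by blast

lemma cycle_typeE:
  assumes "a \<in> cycle_type G p q"
  obtains x y where "rel x y" "a = Elem (x \<cdot> q) (y \<cdot> q)" | u where "suffix_path G u q" "a = Elem u u"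
  using assms unfolding cycle_type_eq by blast

lemma rel_in_carrier: "rel x y \<Longrightarrow> Elem (x \<cdot> q) (y \<cdot> q) \<in> gis_carrier G"
  using rel_power_suffix power_suffix_comp_q rel_src by simp

lemma cycle_type_subset_carrier: "cycle_type G p q \<subseteq> gis_carrier G"
proof
  fix a assume "a \<in> cycle_type G p q"
  then show "a \<in> gis_carrier G"
    by (cases rule: cycle_typeE) (use rel_in_carrier in \<open>auto simp: suffix_path_iff\<close>)
qed

text \<open>The inner paths \<open>y\<close> and \<open>z\<close> are comparable. If
  \<open>y = c \<cdot> z\<close>, shifting the pair \<open>z\<close>, \<open>w\<close> by
  \<open>c\<close> and transitivity relate \<open>x\<close> to \<open>c \<cdot> w\<close>; the other
  case is symmetric.\<close>

lemma rel_mult_rel: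
  assumes xy: "rel x y" and zw: "rel z w"
  shows "gis_mult G (Elem (x \<cdot> q) (y \<cdot> q)) (Elem (z \<cdot> q) (w \<cdot> q)) \<in> cycle_type G p q"
proof -
  consider "suffix_path G z y" | "suffix_path G y z"
    using power_suffix_linear rel_power_suffix xy zw by metis
  then show ?thesis
  proof cases
    case 1
    then obtain c where c: "c \<in> paths G" "tgt G c = src z" "y = c \<cdot> z" by (auto elim: suffix_pathE)
    have "rel (c \<cdot> z) (c \<cdot> w)" using rel_shift[OF zw] c rel_power_suffix[OF xy] by simp
    then have "rel x (c \<cdot> w)" using xy c(3) rel_trans by blast
    moreover have "gis_mult G (Elem (x \<cdot> q) (c \<cdot> z \<cdot> q)) (Elem (z \<cdot> q) (w \<cdot> q)) = Elem (x \<cdot> q) (c \<cdot> w \<cdot> q)"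
      using c rel_in_carrier[OF zw] by (intro mult_Elem_left) auto
    ultimately show ?thesis using rel_in_cycle_type[of x "c \<cdot> w"] c(3) by (simp add: comp_assoc)
  next
    case 2
    then obtain c where c: "c \<in> paths G" "tgt G c = src y" "z = c \<cdot> y" by (auto elim: suffix_pathE)
    have "rel (c \<cdot> y) (c \<cdot> x)" using rel_shift[OF rel_sym[OF xy]] c rel_power_suffix[OF zw] by simp
    then have "rel (c \<cdot> x) w" using zw c(3) rel_trans rel_sym by blast
    moreover have "gis_mult G (Elem (x \<cdot> q) (y \<cdot> q)) (Elem (c \<cdot> y \<cdot> q) (w \<cdot> q)) = Elem (c \<cdot> x \<cdot> q) (w \<cdot> q)"
      using c rel_in_carrier[OF xy] rel_src[OF zw] by (intro mult_Elem_right) auto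
    ultimately show ?thesis using rel_in_cycle_type[of "c \<cdot> x" w] c(3) by (simp add: comp_assoc)
  qed
qed

text \<open>Both components end in \<open>q\<close> and hence in \<open>u\<close>, so the idempotent
  at \<open>u\<close> acts as an identity on either side.\<close>

lemma suffix_mult_rel:
  assumes u: "suffix_path G u q" and xy: "rel x y"
  shows "gis_mult G (Elem u u) (Elem (x \<cdot> q) (y \<cdot> q)) = Elem (x \<cdot> q) (y \<cdot> q)"
    and "gis_mult G (Elem (x \<cdot> q) (y \<cdot> q)) (Elem u u) = Elem (x \<cdot> q) (y \<cdot> q)"
proof -
  obtain c where c: "c \<in> paths G" "u \<in> paths G" "tgt G c = src u" "q = c \<cdot> u"
    using u by (rule suffix_pathE)
  then have src_c: "src c = src p" using arg_cong[OF c(4), of src] q(2) by simp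
  have xc: "z \<cdot> c \<in> paths G" "tgt G (z \<cdot> c) = src u" if "z \<in> power_suffixes" for z
    using power_suffix[OF that] c(1-3) src_c by (simp_all add: comp_in_paths tgt_comp)
  have "gis_mult G (Elem u u) (Elem ((x \<cdot> c) \<cdot> u) (y \<cdot> q)) = Elem ((x \<cdot> c) \<cdot> u) (y \<cdot> q)"
    using xc[of x] rel_power_suffix[OF xy] rel_src[OF xy] c(2) by (intro mult_Elem_right) simp_all
  then show "gis_mult G (Elem u u) (Elem (x \<cdot> q) (y \<cdot> q)) = Elem (x \<cdot> q) (y \<cdot> q)"
    by (simp add: comp_assoc flip: c(4))
  have "gis_mult G (Elem (x \<cdot> q) ((y \<cdot> c) \<cdot> u)) (Elem u u) = Elem (x \<cdot> q) ((y \<cdot> c) \<cdot> u)"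
    using xc[of y] rel_power_suffix[OF xy] c(2) by (intro mult_Elem_left) simp_all
  then show "gis_mult G (Elem (x \<cdot> q) (y \<cdot> q)) (Elem u u) = Elem (x \<cdot> q) (y \<cdot> q)"
    by (simp add: comp_assoc flip: c(4))
qed

lemma suffix_mult_suffix:
  assumes u: "suffix_path G u q" and v: "suffix_path G v q"
  shows "gis_mult G (Elem u u) (Elem v v) \<in> cycle_type G p q"
proof -
  from suffix_path_linear[OF u v] show ?thesis
  proof
    assume "suffix_path G u v"
    then obtain c where c: "c \<in> paths G" "u \<in> paths G" "tgt G c = src u" "v = c \<cdot> u" by (rule suffix_pathE)
    then have "gis_mult G (Elem u u) (Elem v v) = Elem v v"
      using mult_Elem_right[of c u u v] by simp
    then show ?thesis using suffix_in_cycle_type[OF v] by simp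
  next
    assume "suffix_path G v u"
    then obtain c where c: "c \<in> paths G" "v \<in> paths G" "tgt G c = src v" "u = c \<cdot> v" by (rule suffix_pathE)
    then have "gis_mult G (Elem u u) (Elem v v) = Elem u u"
      using mult_Elem_left[of c v u v] by simp
    then show ?thesis using suffix_in_cycle_type[OF u] by simp
  qed
qed

lemma cycle_type_mult:
  assumes "a \<in> cycle_type G p q" "b \<in> cycle_type G p q"
  shows "gis_mult G a b \<in> cycle_type G p q"
  using assms(1)
proof (cases rule: cycle_typeE)
  case (1 x y)
  from assms(2) show ?thesis
    by (cases rule: cycle_typeE)
      (simp_all only: 1 rel_mult_rel suffix_mult_rel rel_in_cycle_type)
next
  case (2 u)
  from assms(2) show ?thesis
    by (cases rule: cycle_typeE)
      (simp_all only: 2 suffix_mult_suffix suffix_mult_rel rel_in_cycle_type)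
qed

lemma cycle_type_inv:
  assumes "a \<in> cycle_type G p q" shows "gis_inv a \<in> cycle_type G p q"
  using assms
proof (cases rule: cycle_typeE)
  case (1 x y)
  then show ?thesis using rel_in_cycle_type[OF rel_sym[OF 1(1)]] by simp
next
  case (2 u)
  then show ?thesis using suffix_in_cycle_type by simp
qed

text \<open>The core of upward closure. If the removed prefix \<open>c\<close> ends inside
  \<open>y\<close>, what is left of \<open>y\<close> again gives a related pair. Otherwise
  \<open>c = y \<cdot> e\<close> and the non-empty \<open>e\<close> is a prefix of both
  \<open>q\<close> and \<open>pw n \<cdot> q\<close>: for \<open>n = 0\<close> this gives
  \<open>s = t\<close>, and for positive \<open>n\<close> it contradicts
  \<open>no_shared_prefix\<close>.\<close>

lemma power_comp_cancel_in_cycle_type: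
  assumes y: "y \<in> power_suffixes" and st: "s \<in> paths G" "t \<in> paths G" "src s = src t"
    and c: "c \<in> paths G" "tgt G c = src s"
    and eqs: "y \<cdot> pw n \<cdot> q = c \<cdot> s" "y \<cdot> q = c \<cdot> t"
  shows "Elem s t \<in> cycle_type G p q" "Elem t s \<in> cycle_type G p q"
proof -
  note yp = power_suffix[OF y]
  have ct: "tgt G c = src t" using c st by simp
  have yq: "tgt G y = src q" using yp q by simp
  have "Elem s t \<in> cycle_type G p q \<and> Elem t s \<in> cycle_type G p q"
  proof (cases "path_length c \<le> path_length y")
    case True
    obtain e where e: "e \<in> paths G" "tgt G c = src e" "y = c \<cdot> e" "t = e \<cdot> q"
      by (rule comp_eq_comp[OF eqs(2)[symmetric] c(1) st(2) ct yp(1) q(1) yq True])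
    have "c \<cdot> s = c \<cdot> e \<cdot> pw n \<cdot> q" using eqs(1) e(3) by (simp add: comp_assoc)
    then have s: "s = (e \<cdot> pw n) \<cdot> q" using comp_left_cancel[of c s "e \<cdot> pw n \<cdot> q"] e(2) c(2) by (simp add: comp_assoc)
    have eps: "e \<in> power_suffixes"
      using power_suffix_suffix[OF y] suffix_path_compI[OF c(1) e(1,2)] e(3) by simp
    then have "e \<cdot> pw n \<in> power_suffixes" by (rule power_suffix_comp_pw)
    moreover have "(e \<cdot> pw n) \<cdot> pw 0 = e \<cdot> pw n" by simp
    ultimately have "rel (e \<cdot> pw n) e" using eps unfolding rel_def by blast
    then show ?thesis unfolding s e(4) using rel_in_cycle_type rel_sym by blast
  next
    case False
    then have "path_length y \<le> path_length c" by simp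
    then obtain e where e: "e \<in> paths G" "tgt G y = src e" "tgt G e = src t" "c = y \<cdot> e" "q = e \<cdot> t"
      by (rule comp_eq_comp[OF eqs(2) yp(1) q(1) yq c(1) st(2) ct])
    have "y \<cdot> pw n \<cdot> q = y \<cdot> e \<cdot> s" using eqs(1) e(4) by (simp add: comp_assoc)
    moreover have "src (pw n \<cdot> q) = src (e \<cdot> s)" using e(2) yp(2) by simp
    ultimately have es: "pw n \<cdot> q = e \<cdot> s" by (rule comp_left_cancel)
    show ?thesis
    proof (cases n)
      case 0
      then have "e \<cdot> s = q" using es q(2) by simp
      then have "e \<cdot> s = e \<cdot> t" using e(5) by simp
      then have "s = t" using st(3) by (rule comp_left_cancel)
      moreover have "suffix_path G t q" unfolding e(5) using e(1) st(2) e(3) by (rule suffix_path_compI)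
      ultimately show ?thesis using suffix_in_cycle_type by simp
    next
      case (Suc m)
      then have "path_length e = 0" using no_shared_prefix[OF e(5), of m s] es by simp
      then show ?thesis using False e(4) by simp
    qed
  qed
  then show "Elem s t \<in> cycle_type G p q" "Elem t s \<in> cycle_type G p q" by auto
qed

lemma cycle_type_upward:
  assumes a: "a \<in> cycle_type G p q" and le: "natural_le (gis_carrier G) (gis_mult G) a b"
  shows "b \<in> cycle_type G p q"
  using a
proof (cases rule: cycle_typeE)
  case (1 x y)
  obtain c s t where b: "b = Elem s t" and st: "s \<in> paths G" "t \<in> paths G" "src s = src t"
    and c: "c \<in> paths G" "tgt G c = src s" "x \<cdot> q = c \<cdot> s" "y \<cdot> q = c \<cdot> t"
    using le[unfolded 1(2) natural_le_Elem[OF rel_in_carrier[OF 1(1)]]] by auto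
  note xy = rel_power_suffix[OF 1(1)]
  \<comment> \<open>The two alternatives are the same cancellation with \<open>s\<close> and
    \<open>t\<close> exchanged.\<close>
  obtain n where "x = y \<cdot> pw n \<or> y = x \<cdot> pw n" using rel_iff[OF 1(1)] by blast
  then show ?thesis
  proof
    assume "x = y \<cdot> pw n"
    then have "y \<cdot> pw n \<cdot> q = c \<cdot> s" using c(3) by (simp add: comp_assoc)
    then show ?thesis unfolding b
      using power_comp_cancel_in_cycle_type(1)[OF xy(2) st c(1,2) _ c(4)] by blast
  next
    assume "y = x \<cdot> pw n"
    then have "x \<cdot> pw n \<cdot> q = c \<cdot> t" using c(4) by (simp add: comp_assoc)
    moreover have "tgt G c = src t" using c(2) st(3) by simp
    ultimately show ?thesis unfolding b
      using power_comp_cancel_in_cycle_type(2)[OF xy(1) st(2,1) st(3)[symmetric] c(1) _ _ c(3)] by blast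
  qed
next
  case (2 u)
  then have "Elem u u \<in> gis_carrier G" by (simp add: suffix_path_iff)
  from le[unfolded 2(2) natural_le_Elem[OF this]]
  obtain c s t where b: "b = Elem s t" and st: "s \<in> paths G" "t \<in> paths G" "src s = src t"
    and c: "c \<in> paths G" "tgt G c = src s" "u = c \<cdot> s" "u = c \<cdot> t"
    by auto
  have "c \<cdot> s = c \<cdot> t" using c(3,4) by simp
  then have "s = t" using st(3) by (rule comp_left_cancel)
  moreover have "suffix_path G s u" unfolding c(3) using c(1) st(1) c(2) by (rule suffix_path_compI)
  ultimately show ?thesis using b 2 suffix_path_trans suffix_in_cycle_type by blast
qed

lemma closed_inverse_subsemigroup_cycle_type:
  "closed_inverse_subsemigroup (gis_carrier G) (gis_mult G) gis_inv (cycle_type G p q)"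
proof -
  have "Elem q q \<in> cycle_type G p q" using suffix_in_cycle_type suffix_path_refl q by blast
  then show ?thesis
    unfolding closed_inverse_subsemigroup_def inverse_subsemigroup_def closed_subset_def
    using cycle_type_subset_carrier cycle_type_mult cycle_type_inv cycle_type_upward by blast
qed

lemma generator_in_cycle_type: "Elem q (p \<cdot> q) \<in> cycle_type G p q"
proof -
  have "pw 0 \<cdot> pw 1 = pw 1 \<cdot> pw 0" by simp
  then have "rel (pw 0) (pw 1)" using pw_in_power_suffixes unfolding rel_def by blast
  then show ?thesis using rel_in_cycle_type[of "pw 0" "pw 1"] q by simp
qed

section \<open>Closed inverse subsemigroups containing the generator\<close>

context
  fixes L
  assumes L: "zero_free_closed G L" and gen: "Elem q (p \<cdot> q) \<in> L"
begin

interpretation zero_free_closed G L by (rule L)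

text \<open>Extending the generator by \<open>pw n\<close> relates each power to the next, and
  transitivity links them to \<open>q\<close>.\<close>

lemma Elem_power: "Elem q (pw n \<cdot> q) \<in> L"
proof (induction n)
  case 0
  then show ?case using Elem_refl(1)[OF gen] q by simp
next
  case (Suc n)
  have "Elem (pw n \<cdot> q) (pw n \<cdot> p \<cdot> q) \<in> L"
    using Elem_extend[OF Elem_refl(2)[OF Suc] gen] pw q by simp
  also have "pw n \<cdot> p \<cdot> q = pw (Suc n) \<cdot> q" by (simp add: path_power_comm flip: comp_assoc)
  finally show ?case using Elem_trans[OF Suc] by blast
qed

text \<open>All \<open>pw m \<cdot> q\<close> are equivalent to \<open>q\<close>, hence to each
  other. The prefix \<open>v\<close> can be added because \<open>v \<cdot> pw m \<cdot> q\<close> is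
  a suffix of \<open>pw (Suc m) \<cdot> q\<close> and so lies on the diagonal.\<close>

lemma cycle_type_subset: "cycle_type G p q \<subseteq> L"
proof -
  have "Elem (v \<cdot> pw m \<cdot> q) (v \<cdot> pw n \<cdot> q) \<in> L" if "suffix_path G v p" for v m n
  proof -
    obtain c where c: "c \<in> paths G" "v \<in> paths G" "tgt G c = src v" "p = c \<cdot> v"
      using \<open>suffix_path G v p\<close> by (rule suffix_pathE)
    have v: "tgt G v = src p" using that p by (simp add: suffix_path_iff)
    have pq: "pw m \<cdot> q \<in> paths G" using pw q by (simp add: comp_in_paths)
    have "suffix_path G (v \<cdot> pw m \<cdot> q) (c \<cdot> v \<cdot> pw m \<cdot> q)"
      using c(1-3) v pq by (intro suffix_path_compI) (simp_all add: comp_in_paths)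
    also have "c \<cdot> v \<cdot> pw m \<cdot> q = pw (Suc m) \<cdot> q" using c(4) by (simp add: comp_assoc)
    finally have "Elem (v \<cdot> pw m \<cdot> q) (v \<cdot> pw m \<cdot> q) \<in> L"
      by (rule Elem_suffix[OF Elem_refl(2)[OF Elem_power]])
    moreover have "Elem (pw m \<cdot> q) (pw n \<cdot> q) \<in> L"
      by (rule Elem_trans[OF Elem_sym[OF Elem_power] Elem_power])
    ultimately show ?thesis by (rule Elem_extend) (use c(2) v in simp_all)
  qed
  moreover have "Elem u u \<in> L" if "suffix_path G u q" for u
    using Elem_suffix[OF Elem_refl(1)[OF gen] that] .
  ultimately show ?thesis unfolding cycle_type_def by blast
qed

lemma Elem_ge:
  assumes "Elem a a \<in> L" "path_length q \<le> path_length a"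
  shows "\<exists>x \<in> power_suffixes. a = x \<cdot> q"
proof -
  \<comment> \<open>Since \<open>p\<close> has at least one arc, this exponent makes the power at
    least as long as \<open>a\<close>.\<close>
  let ?n = "path_length a"
  have "?n \<le> ?n * path_length p" using p(3) by simp
  then have "?n \<le> path_length (pw ?n \<cdot> q)" by (simp add: trans_le_add1)
  then have a: "suffix_path G a (pw ?n \<cdot> q)"
    by (rule suffix_of_length[OF assms(1) Elem_refl(2)[OF Elem_power]])
  have "suffix_path G q a" by (rule suffix_of_length[OF Elem_refl(1)[OF gen] assms])
  then obtain x where x: "x \<in> paths G" "tgt G x = src q" "a = x \<cdot> q" by (auto elim: suffix_pathE)
  have "suffix_path G (x \<cdot> q) (pw ?n \<cdot> q)" using a x(3) by simp
  then have "suffix_path G x (pw ?n)"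
    by (rule suffix_path_comp_cancel) (use x(1,2) pw q(2) in simp_all)
  then show ?thesis using x unfolding power_suffixes_def by blast
qed

text \<open>The hypothesis \<open>min\<close> says that \<open>p\<close> is the period: no partner
  of \<open>q\<close> has length strictly between those of \<open>q\<close> and
  \<open>p \<cdot> q\<close>. Completing \<open>x\<close> to a power by a prefix \<open>c\<close>
  moves the pair to one starting at \<open>q\<close>; the remainder of \<open>c \<cdot> y\<close>
  modulo \<open>p\<close> must then be empty, so \<open>c \<cdot> x\<close> and
  \<open>c \<cdot> y\<close> are both powers of \<open>p\<close>.\<close>

lemma Elem_imp_rel:
  assumes min: "\<And>u. Elem q u \<in> L \<Longrightarrow> path_length q < path_length u \<Longrightarrow> path_length (p \<cdot> q) \<le> path_length u"
    and x: "x \<in> power_suffixes" and y: "y \<in> power_suffixes" and xy: "Elem (x \<cdot> q) (y \<cdot> q) \<in> L"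
  shows "rel x y"
proof -
  have src_xy: "src x = src y" using in_paths(3)[OF xy] by simp
  obtain n where "suffix_path G x (pw n)" using x unfolding power_suffixes_def by blast
  then obtain c where c: "c \<in> paths G" "tgt G c = src x" "pw n = c \<cdot> x" by (rule suffix_pathE)
  have pn: "pw n \<cdot> q = c \<cdot> x \<cdot> q" by (simp add: c(3) comp_assoc)
  have "Elem (c \<cdot> x \<cdot> q) (c \<cdot> x \<cdot> q) \<in> L" using Elem_refl(2)[OF Elem_power, of n] pn by simp
  from Elem_extend[OF this xy] have "Elem (pw n \<cdot> q) (c \<cdot> y \<cdot> q) \<in> L" using c pn by simp
  then have qz: "Elem q (c \<cdot> y \<cdot> q) \<in> L" by (rule Elem_trans[OF Elem_power])
  obtain z where z: "z \<in> power_suffixes" "(c \<cdot> y) \<cdot> q = z \<cdot> q"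
    using Elem_ge[OF Elem_refl(2)[OF qz]] by (auto simp: comp_assoc)
  then have "c \<cdot> y \<in> power_suffixes" using comp_right_cancel by metis
  from power_suffix_decomp[OF this] obtain w s where
    w: "c \<cdot> y = w \<cdot> pw s" "suffix_path G w p" "path_length w < path_length p" by blast
  have wp: "w \<in> paths G" "tgt G w = src p" using w(2) p by (auto simp: suffix_path_iff)
  have "rel w w" using power_suffix_suffix[OF p_in_power_suffixes w(2)] by (rule rel_refl)
  then have "Elem (w \<cdot> q) (w \<cdot> q) \<in> L" using rel_in_cycle_type cycle_type_subset by blast
  then have "Elem (w \<cdot> q) (w \<cdot> pw s \<cdot> q) \<in> L"
    using Elem_extend[OF _ Elem_power] wp q by simp
  moreover have "w \<cdot> pw s \<cdot> q = c \<cdot> y \<cdot> q" using w(1) by (simp flip: comp_assoc)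
  ultimately have "Elem (w \<cdot> q) (c \<cdot> y \<cdot> q) \<in> L" by simp
  from Elem_trans[OF qz Elem_sym[OF this]] have "Elem q (w \<cdot> q) \<in> L" .
  \<comment> \<open>A non-empty \<open>w\<close>, being shorter than \<open>p\<close>, would give a
    partner \<open>w \<cdot> q\<close> of \<open>q\<close> that violates \<open>min\<close>.\<close>
  then have "path_length w = 0" using min[of "w \<cdot> q"] w(3) by auto
  then have "w = (src p, [])" using path_length_0[of w] wp by (metis tgt_empty)
  then have cy: "c \<cdot> y = pw s" using w(1) by simp
  have "c \<cdot> x \<cdot> pw s = pw (n + s)" using c(3) by (simp add: path_power_add comp_assoc)
  also have "\<dots> = pw (s + n)" by (simp add: add.commute)
  also have "\<dots> = c \<cdot> y \<cdot> pw n" by (simp add: path_power_add comp_assoc flip: cy)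
  finally have "x \<cdot> pw s = y \<cdot> pw n" by (rule comp_left_cancel[of c]) (use src_xy in simp_all)
  then show ?thesis using x y unfolding rel_def by blast
qed

end

text \<open>A closed inverse subsemigroup containing \<open>Zero\<close> is the whole carrier; the
  others are covered by \<open>cycle_type_subset\<close>.\<close>

lemma smallest_cycle_type:
  "smallest_closed_inverse_subsemigroup_containing (gis_carrier G) (gis_mult G) gis_inv
     (Elem q (p \<cdot> q)) (cycle_type G p q)"
proof -
  have "cycle_type G p q \<subseteq> B"
    if B: "closed_inverse_subsemigroup (gis_carrier G) (gis_mult G) gis_inv B" "Elem q (p \<cdot> q) \<in> B" for B
  proof (cases "Zero \<in> B")
    case True
    then show ?thesis using Zero_in_closed[OF B(1)] cycle_type_subset_carrier by simp
  next
    case False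
    then have "zero_free_closed G B" using B by unfold_locales
    then show ?thesis using cycle_type_subset B(2) by blast
  qed
  then show ?thesis
    unfolding smallest_closed_inverse_subsemigroup_containing_def
    using closed_inverse_subsemigroup_cycle_type generator_in_cycle_type by blast
qed

end

section \<open>Classification of the zero-free closed inverse subsemigroups\<close>

context zero_free_closed
begin

text \<open>On idempotents the natural order is the reversed suffix order, so \<open>linear\<close>
  gives the chain.\<close>

lemma chain_of_idempotents_if_diagonal:
  assumes "\<And>t u. Elem t u \<in> L \<Longrightarrow> t = u"
  shows "chain_of_idempotents (gis_carrier G) (gis_mult G) L"
proof -
  have diag: "\<exists>u. a = Elem u u \<and> u \<in> paths G" if "a \<in> L" for a
    using that assms Zero_notin in_paths by (cases a) auto
  have le: "natural_le (gis_carrier G) (gis_mult G) (Elem v v) (Elem u u)" if "suffix_path G u v" for u v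
    using that by (subst natural_le_Elem) (auto simp: suffix_path_def)
  have "natural_le (gis_carrier G) (gis_mult G) a b \<or> natural_le (gis_carrier G) (gis_mult G) b a"
    if "a \<in> L" "b \<in> L" for a b
  proof -
    obtain u v where "a = Elem u u" "b = Elem v v" using diag \<open>a \<in> L\<close> \<open>b \<in> L\<close> by blast
    then show ?thesis using linear[of u v] le that by blast
  qed
  moreover have "L \<subseteq> idempotents (gis_carrier G) (gis_mult G)"
    unfolding idempotents_gis using diag by blast
  ultimately show ?thesis unfolding chain_of_idempotents_def by blast
qed

text \<open>Index and period: \<open>q\<close> is a shortest path with a partner other than itself,
  and \<open>r\<close> a shortest partner of \<open>q\<close> that is longer than \<open>q\<close>.
  Both lie in the chain, so \<open>r = p \<cdot> q\<close>, and \<open>p\<close> is a circuit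
  because partners have the same source.\<close>

lemma cycle_type_if_not_diagonal:
  assumes "Elem t u \<in> L" "t \<noteq> u"
  shows "\<exists>p q. cycle_data G p q \<and> L = cycle_type G p q"
proof -
  define off_diag where "off_diag a \<longleftrightarrow> (\<exists>b. Elem a b \<in> L \<and> a \<noteq> b)" for a
  define q where "q = arg_min path_length off_diag"
  have "off_diag t" using assms off_diag_def by blast
  then have "off_diag q" unfolding q_def by (rule arg_min_natI)
  have q_min: "path_length q \<le> path_length a" if "off_diag a" for a
    using that unfolding q_def by (rule arg_min_nat_le)
  obtain b where b: "Elem q b \<in> L" "q \<noteq> b" using \<open>off_diag q\<close> unfolding off_diag_def by blast
  define longer where "longer r \<longleftrightarrow> Elem q r \<in> L \<and> path_length q < path_length r" for r
  have "off_diag b" using b Elem_sym unfolding off_diag_def by metis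
  then have "path_length q \<le> path_length b" by (rule q_min)
  \<comment> \<open>Distinct paths of the chain differ in length, and \<open>b\<close> is not
    shorter than \<open>q\<close>.\<close>
  then have "longer b"
    using eq_of_length[of q b] Elem_refl[OF b(1)] b unfolding longer_def by fastforce
  define r where "r = arg_min path_length longer"
  have r_min: "path_length r \<le> path_length a" if "longer a" for a
    using that unfolding r_def by (rule arg_min_nat_le)
  have "longer r" using \<open>longer b\<close> unfolding r_def by (rule arg_min_natI)
  then have r: "Elem q r \<in> L" "path_length q < path_length r" unfolding longer_def by auto
  then have "suffix_path G q r" using suffix_of_length Elem_refl[OF r(1)] by simp
  then obtain p where pr: "p \<in> paths G" "q \<in> paths G" "tgt G p = src q" "r = p \<cdot> q" by (auto elim: suffix_pathE)
  have src: "src p = src q" using in_paths[OF r(1)] pr by simp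
  have "\<not> share_nontrivial_prefix G p q"
  proof
    \<comment> \<open>Cancelling the common prefix from the pair \<open>q\<close>,
      \<open>p \<cdot> q\<close> leaves an off-diagonal pair whose first path is shorter than
      \<open>q\<close>, against the choice of \<open>q\<close>.\<close>
    assume "share_nontrivial_prefix G p q"
    then obtain x y z where x: "x \<in> paths G" "path_length x > 0"
      and y: "y \<in> paths G" "tgt G x = src y" "p = x \<cdot> y" and z: "z \<in> paths G" "tgt G x = src z" "q = x \<cdot> z"
      unfolding share_nontrivial_prefix_def prefix_path_def by auto
    have tgt_y: "tgt G y = src q" using pr y by (simp add: tgt_comp)
    have "Elem (x \<cdot> z) (x \<cdot> y \<cdot> q) \<in> L" using r(1) z(3) pr(4) y(3) by (simp add: comp_assoc)
    then have "Elem z (y \<cdot> q) \<in> L"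
      by (rule Elem_cancel[of x]) (use x y z pr tgt_y in \<open>simp_all add: comp_in_paths\<close>)
    moreover have "path_length z < path_length (y \<cdot> q)" using z x by simp
    ultimately have "off_diag z" unfolding off_diag_def by fastforce
    then show False using q_min[of z] z(3) x(2) by simp
  qed
  then have cd: "cycle_data G p q"
    using pr r src by (simp add: cycle_data_def directed_circuit_def)
  interpret cycle G p q by unfold_locales (rule cd)
  have L: "zero_free_closed G L" by unfold_locales
  have gen: "Elem q (p \<cdot> q) \<in> L" using r pr by simp
  have min: "path_length (p \<cdot> q) \<le> path_length u" if "Elem q u \<in> L" "path_length q < path_length u" for u
    using r_min[of u] that pr(4) unfolding longer_def by simp
  have "a \<in> cycle_type G p q" if a_in: "a \<in> L" for a
  proof -
    obtain s t where a: "a = Elem s t" using Zero_notin a_in by (cases a) auto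
    have st: "Elem s t \<in> L" using a a_in by simp
    show ?thesis
    proof (cases "path_length q \<le> path_length s \<and> path_length q \<le> path_length t")
      case True
      obtain x y where "x \<in> power_suffixes" "y \<in> power_suffixes" "s = x \<cdot> q" "t = y \<cdot> q"
        using Elem_ge[OF L gen] Elem_refl[OF st] True by metis
      then show ?thesis
        using Elem_imp_rel[OF L gen min] st rel_in_cycle_type a by blast
    next
      case False
      \<comment> \<open>A component shorter than \<open>q\<close> has no partner but itself, so the
        pair is diagonal and given by a suffix of \<open>q\<close>.\<close>
      then have "\<not> off_diag s \<or> \<not> off_diag t" using q_min by blast
      then have "s = t" using st Elem_sym unfolding off_diag_def by blast
      then have "suffix_path G s q"
        using False Elem_refl(1)[OF st] Elem_refl(1)[OF gen] suffix_of_length by simp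
      then show ?thesis using suffix_in_cycle_type a \<open>s = t\<close> by simp
    qed
  qed
  then have "L = cycle_type G p q" using cycle_type_subset[OF L gen] by blast
  then show ?thesis using cd by blast
qed

end

theorem theorem3p1:
  fixes G :: "('a, 'b) pre_digraph"
  assumes "fin_digraph G"
  shows
    "(\<forall>L. closed_inverse_subsemigroup (gis_carrier G) (gis_mult G) gis_inv L \<and> L \<noteq> gis_carrier G \<longrightarrow>
        (finite L \<and> chain_of_idempotents (gis_carrier G) (gis_mult G) L) \<or>
        (infinite L \<and> chain_of_idempotents (gis_carrier G) (gis_mult G) L) \<or>
        (\<exists>p q. cycle_data G p q \<and> L = cycle_type G p q)) \<and>
     (\<forall>p q. cycle_data G p q \<longrightarrow>
        smallest_closed_inverse_subsemigroup_containing (gis_carrier G) (gis_mult G) gis_inv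
          (Elem q (p \<cdot> q)) (cycle_type G p q))"
proof -
  interpret fin_digraph G by (rule assms)
  have "chain_of_idempotents (gis_carrier G) (gis_mult G) L \<or> (\<exists>p q. cycle_data G p q \<and> L = cycle_type G p q)"
    if L: "closed_inverse_subsemigroup (gis_carrier G) (gis_mult G) gis_inv L" "L \<noteq> gis_carrier G" for L
  proof -
    \<comment> \<open>Properness enters here.\<close>
    have "Zero \<notin> L" using L Zero_in_closed by blast
    then interpret zero_free_closed G L using L(1) by unfold_locales
    show ?thesis using chain_of_idempotents_if_diagonal cycle_type_if_not_diagonal by blast
  qed
  moreover have "smallest_closed_inverse_subsemigroup_containing (gis_carrier G) (gis_mult G) gis_inv
          (Elem q (p \<cdot> q)) (cycle_type G p q)" if "cycle_data G p q" for p q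
  proof -
    interpret cycle G p q using that by unfold_locales
    show ?thesis by (rule smallest_cycle_type)
  qed
  ultimately show ?thesis by blast
qed

end
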